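(* Suppose $\alpha>0$ and $\beta\ge 0$. Then $$E_{\alpha,\beta}\text{ is log-convex on }\mathbb{R}^+\iff \alpha\le 1\text{ and }\beta\ge h(\alpha),$$ and $$E_{\alpha,\beta}\text{ is log-concave on }\mathbb{R}^+\iff \alpha\ge 1\text{ and }\beta\le h(\alpha).$$
   Context: For $\alpha>0$ and $\beta\in\mathbb{R}$, the two-parameter Mittag-Leffler function is the entire function $E_{\alpha,\beta}(z)=\sum_{k=0}^{\infty}\frac{z^k}{\Gamma(\alpha k+\beta)}$, $z\in\mathbb{C}$, with the convention $1/\Gamma(s)=0$ at the poles $s=0,-1,-2,\dots$ of $\Gamma$. For each $x>0$, $h(x)$ denotes the unique solution $y=h(x)>0$ of the equation $2\,\Gamma(x+y)^2=\Gamma(y)\,\Gamma(2x+y)$ (existence and uniqueness hold for every $x>0$). $\mathbb{R}^+$ is the positive half-line; $E_{\alpha,\beta}$ is positive on $(0,\infty)$, and log-convex (resp. log-concave) means that $\log E_{\alpha,\beta}$ is convex (resp. concave) there. *)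

theory Defs
  imports "HOL-Analysis.Analysis"
begin

text \<open>
  The library function \<open>rGamma\<close> is the entire reciprocal of \<open>Gamma\<close>, so it vanishes at
  the poles \<open>0, -1, -2, \<dots>\<close>, which is the usual convention for the coefficients.
\<close>

definition mittag_leffler :: "real \<Rightarrow> real \<Rightarrow> complex \<Rightarrow> complex" where
  "mittag_leffler \<alpha> \<beta> z = (\<Sum>k. z ^ k * rGamma (of_real (\<alpha> * real k + \<beta>)))"

text \<open>
  The coefficients are real, so taking the real part only changes the type of the values on the
  real line. For \<open>\<alpha> > 0\<close> and \<open>\<beta> \<ge> 0\<close> these values are positive on \<open>{0<..}\<close>,
  so that \<open>ln\<close> below is only used where it is the logarithm.
\<close>

definition mittag_leffler_real :: "real \<Rightarrow> real \<Rightarrow> real \<Rightarrow> real" where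
  "mittag_leffler_real \<alpha> \<beta> x = Re (mittag_leffler \<alpha> \<beta> (of_real x))"

definition log_convex_on :: "real set \<Rightarrow> (real \<Rightarrow> real) \<Rightarrow> bool" where
  "log_convex_on S f \<longleftrightarrow> convex_on S (\<lambda>x. ln (f x))"

definition log_concave_on :: "real set \<Rightarrow> (real \<Rightarrow> real) \<Rightarrow> bool" where
  "log_concave_on S f \<longleftrightarrow> concave_on S (\<lambda>x. ln (f x))"

text \<open>The description is proper for every \<open>x > 0\<close>; other \<open>x\<close> are irrelevant.\<close>

definition h :: "real \<Rightarrow> real" where
  "h x = (THE y. y > 0 \<and> 2 * Gamma (x + y) ^ 2 = Gamma y * Gamma (2 * x + y))"

end

theory Submission
  imports Defs "HOL-Real_Asymp.Real_Asymp"
begin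

text \<open>
  Put \<open>r(y) = Gamma (y + a) / Gamma y\<close>. With \<open>\<delta>(y) = Digamma (y + a) - Digamma y\<close> one has
  \<open>r'' = r (\<delta>' + \<delta>\<^sup>2)\<close>, and the bracket tends to 0 at infinity while its difference under
  \<open>y \<mapsto> y + 1\<close> has the sign of \<open>Digamma (y + a) - Digamma (y + 1)\<close>; hence \<open>r\<close> is concave for
  \<open>a \<le> 1\<close> and convex for \<open>a \<ge> 1\<close>. Writing \<open>c k\<close> for the Taylor coefficients of \<open>E\<close>, the ratio
  of the \<open>k\<close>-th coefficients of \<open>E'\<close> and \<open>E\<close> is \<open>(k + 1) / r(a k + b)\<close>, so it is monotone in \<open>k\<close>
  as soon as its first step goes in the right direction, and this first step compares \<open>b\<close> with
  \<open>h a\<close>. Monotone coefficient ratios make \<open>E' / E\<close> monotone.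

  Conversely, the sign of \<open>E'' E - E'\<^sup>2\<close> at 0 forces the condition on \<open>b\<close>. The condition on \<open>a\<close>
  comes from \<open>r(a k + b)\<close> growing like \<open>(a k) powr a\<close>: for \<open>a > 1\<close> the quotient \<open>E' / E\<close> becomes
  arbitrarily small, and for \<open>a < 1\<close> arbitrarily large.
\<close>

section \<open>Ratios of Gamma values\<close>

text \<open>The functional equation makes \<open>ln x\<close> the increment of
  \<open>ln_Gamma\<close> over a unit interval; the mean value theorem does the rest.\<close>

lemma ln_eq_Digamma_between:
  fixes x :: real
  assumes "x > 0"
  obtains t where "x < t" "t < x + 1" "ln x = Digamma t"
proof -
  have "\<exists>t. x < t \<and> t < x + 1 \<and> ln_Gamma (x + 1) - ln_Gamma x = (x + 1 - x) * Digamma t"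
    using assms by (intro MVT2) (auto intro!: derivative_eq_intros)
  then obtain t where t: "x < t" "t < x + 1" "ln_Gamma (x + 1) - ln_Gamma x = Digamma t"
    by auto
  have "Gamma (x + 1) = x * Gamma x"
    using assms by (intro Gamma_plus1) (auto elim!: nonpos_Ints_cases)
  hence "ln_Gamma (x + 1) - ln_Gamma x = ln x"
    using assms Gamma_real_pos[of x] by (simp add: ln_Gamma_real_pos ln_mult del: Gamma_real_pos)
  with t that show thesis by metis
qed

lemma Digamma_le_ln: "x > 0 \<Longrightarrow> Digamma x \<le> ln (x::real)"
  by (metis ln_eq_Digamma_between Digamma_real_mono less_imp_le)

lemma ln_le_Digamma: "x > 1 \<Longrightarrow> ln (x - 1) \<le> Digamma (x::real)"
proof -
  assume x: "x > 1"
  then obtain t where "x - 1 < t" "t < x" "ln (x - 1) = Digamma t"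
    using ln_eq_Digamma_between[of "x - 1"] by auto
  with x show ?thesis by (auto intro!: Digamma_real_mono)
qed

text \<open>The unit increment of \<open>Digamma\<close> ending at \<open>x\<close> is
  \<open>1 / (x - 1)\<close>, and by the mean value theorem it is a value of the decreasing
  \<open>Polygamma 1\<close> to the left of \<open>x\<close>.\<close>

lemma Polygamma_1_le: "x > 1 \<Longrightarrow> Polygamma 1 x \<le> 1 / (x - 1 :: real)"
proof -
  assume x: "x > 1"
  have "\<exists>t. x - 1 < t \<and> t < x \<and> Digamma x - Digamma (x - 1) = (x - (x - 1)) * Polygamma (Suc 0) t"
    using x by (intro MVT2) (auto intro!: derivative_eq_intros elim!: nonpos_Ints_cases)
  then obtain t where t: "x - 1 < t" "t < x" "Digamma x - Digamma (x - 1) = Polygamma 1 t"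
    by auto
  moreover have "Digamma x - Digamma (x - 1) = 1 / (x - 1)"
    using Digamma_plus1[of "x - 1"] x by simp
  moreover have "Polygamma 1 x < Polygamma 1 t"
    using t x by (intro Polygamma_real_strict_antimono) auto
  ultimately show ?thesis by simp
qed

lemma Polygamma_1_pos: "x > 0 \<Longrightarrow> Polygamma 1 (x::real) > 0"
  by (rule Polygamma_real_odd_pos) (auto elim!: nonpos_Ints_cases)

text \<open>
  Multiplying by \<open>rGamma\<close> instead of dividing by \<open>Gamma\<close> keeps this continuous at \<open>y = 0\<close>, which
  occurs for \<open>\<beta> = 0\<close>.
\<close>

definition Gamma_ratio :: "real \<Rightarrow> real \<Rightarrow> real" where
  "Gamma_ratio a y = Gamma (y + a) * rGamma y"

definition Digamma_diff :: "real \<Rightarrow> real \<Rightarrow> real" where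
  "Digamma_diff a y = Digamma (y + a) - Digamma y"

definition Gamma_ratio_curvature :: "real \<Rightarrow> real \<Rightarrow> real" where
  "Gamma_ratio_curvature a y =
     Polygamma 1 (y + a) - Polygamma 1 y + (Digamma_diff a y)\<^sup>2"

lemma Gamma_ratio_pos: "a > 0 \<Longrightarrow> y > 0 \<Longrightarrow> Gamma_ratio a y > 0"
  by (simp add: Gamma_ratio_def rGamma_inverse_Gamma)

lemma ln_Gamma_ratio:
  "a > 0 \<Longrightarrow> y > 0 \<Longrightarrow> ln (Gamma_ratio a y) = ln_Gamma (y + a) - ln_Gamma y"
  using Gamma_real_pos[of y] Gamma_real_pos[of "y + a"]
  by (simp add: Gamma_ratio_def rGamma_inverse_Gamma ln_mult ln_inverse ln_Gamma_real_pos
      del: Gamma_real_pos)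

lemma ln_Gamma_ratio_eq_Digamma:
  assumes "a > 0" "y > 0"
  obtains t where "y < t" "t < y + a" "ln (Gamma_ratio a y) = a * Digamma t"
proof -
  have "\<exists>t. y < t \<and> t < y + a \<and> ln_Gamma (y + a) - ln_Gamma y = (y + a - y) * Digamma t"
    using assms by (intro MVT2) (auto intro!: derivative_eq_intros)
  thus thesis using that assms by (auto simp: ln_Gamma_ratio)
qed

text \<open>\<open>Digamma\<close> at the intermediate point is at most its value at the right end,
  hence at most a logarithm. With the lower bound below this fixes the growth order
  \<open>y powr a\<close>, the only asymptotic information used about the coefficients.\<close>

lemma Gamma_ratio_upper:
  assumes "a > 0" "y > 0"
  shows "Gamma_ratio a y \<le> (y + a) powr a"
proof -
  obtain t where t: "y < t" "t < y + a" "ln (Gamma_ratio a y) = a * Digamma t"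
    using ln_Gamma_ratio_eq_Digamma assms by blast
  have "Digamma t \<le> Digamma (y + a)"
    using t assms by (intro Digamma_real_mono) auto
  also have "\<dots> \<le> ln (y + a)" using assms by (intro Digamma_le_ln) auto
  finally have "ln (Gamma_ratio a y) \<le> ln ((y + a) powr a)"
    using t assms by (simp add: ln_powr)
  thus ?thesis using assms Gamma_ratio_pos by (subst (asm) ln_le_cancel_iff) auto
qed

lemma Gamma_ratio_lower:
  assumes "a > 0" "y > 1"
  shows "(y - 1) powr a \<le> Gamma_ratio a y"
proof -
  obtain t where t: "y < t" "t < y + a" "ln (Gamma_ratio a y) = a * Digamma t"
    using ln_Gamma_ratio_eq_Digamma[of a y] assms by auto
  have "ln (y - 1) \<le> Digamma y" using assms by (intro ln_le_Digamma) auto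
  also have "Digamma y \<le> Digamma t"
    using t assms by (intro Digamma_real_mono) auto
  finally have "ln ((y - 1) powr a) \<le> ln (Gamma_ratio a y)"
    using t assms by (simp add: ln_powr)
  thus ?thesis using assms Gamma_ratio_pos[of a y] by (subst (asm) ln_le_cancel_iff) auto
qed

lemma Digamma_diff_nonneg: "a > 0 \<Longrightarrow> y > 0 \<Longrightarrow> Digamma_diff a y \<ge> 0"
  by (simp add: Digamma_diff_def Digamma_real_mono)

lemma Digamma_diff_tendsto_0:
  assumes "a > 0"
  shows "(Digamma_diff a \<longlongrightarrow> 0) at_top"
proof (rule tendsto_sandwich)
  show "\<forall>\<^sub>F y in at_top. 0 \<le> Digamma_diff a y"
    using eventually_gt_at_top[of 0] by eventually_elim (simp add: Digamma_diff_nonneg assms)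
  show "\<forall>\<^sub>F y in at_top. Digamma_diff a y \<le> ln (y + a) - ln (y - 1)"
    using eventually_gt_at_top[of 1]
  proof eventually_elim
    case (elim y)
    thus ?case using Digamma_le_ln[of "y + a"] ln_le_Digamma[of y] assms
      by (simp add: Digamma_diff_def)
  qed
  show "((\<lambda>y. ln (y + a) - ln (y - 1)) \<longlongrightarrow> 0) at_top" by real_asymp
qed auto

lemma Polygamma_1_tendsto_0: "(Polygamma 1 \<longlongrightarrow> (0::real)) at_top"
proof (rule tendsto_sandwich)
  show "\<forall>\<^sub>F y in at_top. 0 \<le> Polygamma 1 (y::real)"
    using eventually_gt_at_top[of 0]
    by eventually_elim (use Polygamma_1_pos in \<open>auto intro: less_imp_le\<close>)
  show "\<forall>\<^sub>F y in at_top. Polygamma 1 y \<le> 1 / (y - 1 :: real)"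
    using eventually_gt_at_top[of 1] by eventually_elim (rule Polygamma_1_le)
  show "((\<lambda>y. 1 / (y - 1 :: real)) \<longlongrightarrow> 0) at_top" by real_asymp
qed auto

section \<open>Sign of the curvature and shape of the Gamma quotient\<close>

lemma Gamma_ratio_curvature_tendsto_0:
  assumes "a > 0"
  shows "(Gamma_ratio_curvature a \<longlongrightarrow> 0) at_top"
proof -
  have "((\<lambda>y. Polygamma 1 (y + a)) \<longlongrightarrow> 0) at_top"
    by (rule filterlim_compose[OF Polygamma_1_tendsto_0]) real_asymp
  hence "((\<lambda>y. Polygamma 1 (y + a) - Polygamma 1 y + (Digamma_diff a y)\<^sup>2) \<longlongrightarrow> 0 - 0 + 0\<^sup>2) at_top"
    by (intro tendsto_intros Polygamma_1_tendsto_0 Digamma_diff_tendsto_0 assms)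
  thus ?thesis by (simp add: Gamma_ratio_curvature_def[abs_def])
qed

text \<open>With \<open>u = 1 / y\<close>, \<open>v = 1 / (y + a)\<close> and
  \<open>D = Digamma_diff a y\<close>, the recurrences give
  \<open>v^2 - u^2 + D^2 - (D + v - u)^2 = 2 * (u - v) * (D - u)\<close>, and \<open>D - u\<close>
  is the last factor.\<close>

lemma Gamma_ratio_curvature_diff:
  assumes "a > 0" "y > 0"
  shows "Gamma_ratio_curvature a y - Gamma_ratio_curvature a (y + 1) =
    2 * (1 / y - 1 / (y + a)) * (Digamma (y + a) - Digamma (y + 1))"
proof -
  have P: "Polygamma 1 (x + 1) = Polygamma 1 x - (1 / x)\<^sup>2" if "x > 0" for x :: real
    using Polygamma_plus1[of x 1] that by (simp add: power_divide power2_eq_square)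
  have D: "Digamma (x + 1) = Digamma x + 1 / x" if "x > 0" for x :: real
    using Digamma_plus1[of x] that by simp
  have s: "y + 1 + a = (y + a) + 1" by simp
  show ?thesis
    unfolding Gamma_ratio_curvature_def Digamma_diff_def s
    using assms by (simp only: P D add_pos_pos) algebra
qed

text \<open>Along the translates \<open>y + n\<close> the curvature is monotone with limit 0, so its
  first term lies on the side from which the limit is approached.\<close>

lemma Gamma_ratio_curvature_sign:
  assumes "a > 0" "y > 0"
  shows "a \<ge> 1 \<Longrightarrow> Gamma_ratio_curvature a y \<ge> 0"
    and "a \<le> 1 \<Longrightarrow> Gamma_ratio_curvature a y \<le> 0"
proof -
  let ?s = "\<lambda>n. Gamma_ratio_curvature a (y + real n)"
  have lim: "?s \<longlonglongrightarrow> 0"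
    by (rule filterlim_compose[OF Gamma_ratio_curvature_tendsto_0[OF assms(1)]]) real_asymp
  have step: "?s n - ?s (Suc n) =
      2 * (1 / (y + real n) - 1 / (y + real n + a)) *
        (Digamma (y + real n + a) - Digamma (y + real n + 1))" for n
    using Gamma_ratio_curvature_diff[of a "y + real n"] assms by (simp add: add_ac)
  have c: "2 * (1 / (y + real n) - 1 / (y + real n + a)) \<ge> 0" for n
    using assms by (simp add: frac_le)
  {
    assume "a \<ge> 1"
    hence "?s n - ?s (Suc n) \<ge> 0" for n
      unfolding step using assms c
      by (intro mult_nonneg_nonneg[OF c]) (simp add: Digamma_real_mono)
    hence "decseq ?s" by (intro decseq_SucI) simp
    from decseq_ge[OF this lim, of 0] show "Gamma_ratio_curvature a y \<ge> 0" by simp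
  }
  {
    assume "a \<le> 1"
    hence "?s n - ?s (Suc n) \<le> 0" for n
      unfolding step using assms c
      by (intro mult_nonneg_nonpos[OF c]) (simp add: Digamma_real_mono)
    hence "incseq ?s" by (intro incseq_SucI) simp
    from incseq_le[OF this lim, of 0] show "Gamma_ratio_curvature a y \<le> 0" by simp
  }
qed

lemma Gamma_ratio_has_derivative:
  assumes "a > 0" "y > 0"
  shows "(Gamma_ratio a has_real_derivative Gamma_ratio a y * Digamma_diff a y) (at y)"
  unfolding Gamma_ratio_def[abs_def] Digamma_diff_def using assms
  by (auto intro!: derivative_eq_intros elim!: nonpos_Ints_cases simp: algebra_simps)

lemma Gamma_ratio_has_second_derivative:
  assumes "a > 0" "y > 0"
  shows "((\<lambda>y. Gamma_ratio a y * Digamma_diff a y) has_real_derivative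
    Gamma_ratio a y * Gamma_ratio_curvature a y) (at y)"
proof -
  have "(Digamma_diff a has_real_derivative Polygamma 1 (y + a) - Polygamma 1 y) (at y)"
    unfolding Digamma_diff_def[abs_def] using assms
    by (auto intro!: derivative_eq_intros elim!: nonpos_Ints_cases)
  from DERIV_mult[OF Gamma_ratio_has_derivative[OF assms] this]
  show ?thesis
    by (simp add: Gamma_ratio_curvature_def power2_eq_square algebra_simps)
qed

lemma Gamma_ratio_convex:
  assumes "a \<ge> 1"
  shows "convex_on {0<..} (Gamma_ratio a)"
  using assms Gamma_ratio_curvature_sign(1)[of a] Gamma_ratio_pos[of a]
  by (intro f''_ge0_imp_convex[OF _ Gamma_ratio_has_derivative Gamma_ratio_has_second_derivative])
     (auto simp: less_imp_le)

lemma Gamma_ratio_concave: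
  assumes "0 < a" "a \<le> 1"
  shows "concave_on {0<..} (Gamma_ratio a)"
  using assms Gamma_ratio_curvature_sign(2)[of a] Gamma_ratio_pos[of a]
  by (intro f''_le0_imp_concave[OF _ Gamma_ratio_has_derivative Gamma_ratio_has_second_derivative])
     (auto simp: mult_nonneg_nonpos less_imp_le)

lemma continuous_Gamma_ratio:
  assumes "a > 0"
  shows "continuous_on {0..} (Gamma_ratio a)"
  unfolding Gamma_ratio_def[abs_def] using assms
  by (intro continuous_intros continuous_on_compose2[OF continuous_on_Gamma[of "{0<..}"]]) (auto elim!: nonpos_Ints_cases)

text \<open>Midpoint convexity on the open half-line, carried to \<open>y = 0\<close> by continuity.
  The endpoint occurs for the coefficient of index 0 when \<open>b = 0\<close>.\<close>

lemma Gamma_ratio_second_difference_nonneg: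
  assumes "a \<ge> 1" "y \<ge> 0"
  shows "2 * Gamma_ratio a (y + a) \<le> Gamma_ratio a y + Gamma_ratio a (y + 2 * a)"
proof -
  have midpoint_shift: "(1 - 1/2) *\<^sub>R t + (1/2) *\<^sub>R (t + 2 * a) = t + a" for t :: real
    by (simp add: field_simps)
  have pos: "2 * Gamma_ratio a (t + a) \<le> Gamma_ratio a t + Gamma_ratio a (t + 2 * a)" if "t > 0" for t
    using convex_onD[OF Gamma_ratio_convex[OF assms(1)], of "1/2" t "t + 2 * a"] that assms
      midpoint_shift[of t]
    by simp
  \<comment> \<open>The points \<open>y + 1 / (n + 1)\<close> are positive, so the open half-line
    case applies to them.\<close>
  have *: "(\<lambda>n. Gamma_ratio a (y + 1 / real (Suc n) + c)) \<longlonglongrightarrow> Gamma_ratio a (y + c)" if "c \<ge> 0" for c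
  proof (rule continuous_on_tendsto_compose[OF continuous_Gamma_ratio[of a]])
    show "(\<lambda>n. y + 1 / real (Suc n) + c) \<longlonglongrightarrow> y + c" by real_asymp
  qed (use assms that in auto)
  have "(\<lambda>n. Gamma_ratio a (y + 1 / real (Suc n)) + Gamma_ratio a (y + 1 / real (Suc n) + 2 * a)
      - 2 * Gamma_ratio a (y + 1 / real (Suc n) + a))
    \<longlonglongrightarrow> Gamma_ratio a y + Gamma_ratio a (y + 2 * a) - 2 * Gamma_ratio a (y + a)"
    using assms *[of 0] by (intro tendsto_intros *) auto
  moreover have "0 \<le> Gamma_ratio a (y + 1 / real (Suc n)) + Gamma_ratio a (y + 1 / real (Suc n) + 2 * a)
      - 2 * Gamma_ratio a (y + 1 / real (Suc n) + a)" for n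
    using pos[of "y + 1 / real (Suc n)"] assms by (simp add: add_nonneg_pos)
  ultimately have "0 \<le> Gamma_ratio a y + Gamma_ratio a (y + 2 * a) - 2 * Gamma_ratio a (y + a)"
    by (intro LIMSEQ_le_const) auto
  thus ?thesis by simp
qed

lemma Gamma_ratio_second_difference_nonpos:
  assumes "0 < a" "a \<le> 1" "y > 0"
  shows "Gamma_ratio a y + Gamma_ratio a (y + 2 * a) \<le> 2 * Gamma_ratio a (y + a)"
proof -
  have "(1 - 1/2) *\<^sub>R y + (1/2) *\<^sub>R (y + 2 * a) = y + a"
    by (simp add: field_simps)
  thus ?thesis
    using convex_onD[OF Gamma_ratio_concave[unfolded concave_on_def], of a "1/2" y "y + 2 * a"] assms
    by simp
qed

section \<open>The threshold function\<close>

text \<open>The logarithm \<open>?q\<close> of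
  \<open>Gamma y * Gamma (2 * a + y) / (Gamma (a + y))\<^sup>2\<close> is strictly decreasing, so
  the solution is unique and every \<open>y\<close> can be compared with it through the sign of
  \<open>?q y - ln 2\<close>.\<close>

lemma h_threshold:
  assumes a: "a > 0"
  shows "h a > 0"
    and "y > 0 \<Longrightarrow> h a \<le> y \<longleftrightarrow> Gamma y * Gamma (2 * a + y) \<le> 2 * (Gamma (a + y))\<^sup>2"
    and "y > 0 \<Longrightarrow> y \<le> h a \<longleftrightarrow> 2 * (Gamma (a + y))\<^sup>2 \<le> Gamma y * Gamma (2 * a + y)"
proof -
  let ?r = "Gamma_ratio a"
  let ?q = "\<lambda>y. ln (?r (y + a)) - ln (?r y)"
  let ?P = "\<lambda>y. y > 0 \<and> 2 * (Gamma (a + y))\<^sup>2 = Gamma y * Gamma (2 * a + y)"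
  have le_iff: "2 * (Gamma (a + y))\<^sup>2 \<le> Gamma y * Gamma (2 * a + y) \<longleftrightarrow> ln 2 \<le> ?q y"
    and ge_iff: "Gamma y * Gamma (2 * a + y) \<le> 2 * (Gamma (a + y))\<^sup>2 \<longleftrightarrow> ?q y \<le> ln 2"
    if y: "y > 0" for y
  proof -
    have p: "Gamma y > 0" "Gamma (a + y) > 0" "Gamma (2 * a + y) > 0"
      using y a by auto
    have "?r (y + a) / ?r y = Gamma y * Gamma (2 * a + y) / (Gamma (a + y))\<^sup>2"
      using p by (simp add: Gamma_ratio_def rGamma_inverse_Gamma field_simps power2_eq_square)
    moreover have "?q y = ln (?r (y + a) / ?r y)"
      using Gamma_ratio_pos[of a y] Gamma_ratio_pos[of a "y + a"] y a by (simp add: ln_div)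
    ultimately have "?q y = ln (Gamma y * Gamma (2 * a + y) / (Gamma (a + y))\<^sup>2)"
      by simp
    moreover have "Gamma y * Gamma (2 * a + y) / (Gamma (a + y))\<^sup>2 > 0"
      using p by simp
    ultimately have "ln 2 \<le> ?q y \<longleftrightarrow> 2 \<le> Gamma y * Gamma (2 * a + y) / (Gamma (a + y))\<^sup>2"
      "?q y \<le> ln 2 \<longleftrightarrow> Gamma y * Gamma (2 * a + y) / (Gamma (a + y))\<^sup>2 \<le> 2"
      by (metis ln_le_cancel_iff zero_less_numeral)+
    with p show "2 * (Gamma (a + y))\<^sup>2 \<le> Gamma y * Gamma (2 * a + y) \<longleftrightarrow> ln 2 \<le> ?q y"
      and "Gamma y * Gamma (2 * a + y) \<le> 2 * (Gamma (a + y))\<^sup>2 \<longleftrightarrow> ?q y \<le> ln 2"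
      by (simp_all add: pos_le_divide_eq pos_divide_le_eq)
  qed
  have dec: "?q z < ?q y" if "0 < y" "y < z" for y z
  proof -
    have deriv: "((\<lambda>y. ln_Gamma (y + a + a) - ln_Gamma (y + a) - (ln_Gamma (y + a) - ln_Gamma y)) has_real_derivative
       Digamma_diff a (t + a) - Digamma_diff a t) (at t)" if "t > 0" for t
      unfolding Digamma_diff_def using that a by (auto intro!: derivative_eq_intros)
    \<comment> \<open>The derivative of \<open>?q\<close> is the increment of
      \<open>Digamma_diff a\<close> over a step \<open>a\<close>, negative because
      \<open>Polygamma 1\<close> decreases.\<close>
    have neg: "Digamma_diff a (t + a) < Digamma_diff a t" if t: "t > 0" for t
    proof (rule DERIV_neg_imp_decreasing[where f = "Digamma_diff a"])
      show "t < t + a" using a by simp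
      fix x assume x: "t \<le> x"
      have "(Digamma_diff a has_real_derivative Polygamma 1 (x + a) - Polygamma 1 x) (at x)"
        unfolding Digamma_diff_def[abs_def] using x t a
        by (auto intro!: derivative_eq_intros elim!: nonpos_Ints_cases)
      moreover have "Polygamma 1 (x + a) < Polygamma 1 x"
        using x t a by (intro Polygamma_real_strict_antimono) auto
      ultimately show "\<exists>d. (Digamma_diff a has_real_derivative d) (at x) \<and> d < 0" by force
    qed
    have "ln_Gamma (z + a + a) - ln_Gamma (z + a) - (ln_Gamma (z + a) - ln_Gamma z) <
        ln_Gamma (y + a + a) - ln_Gamma (y + a) - (ln_Gamma (y + a) - ln_Gamma y)"
    proof (rule DERIV_neg_imp_decreasing[OF that(2), where f = "\<lambda>y. ln_Gamma (y + a + a) - ln_Gamma (y + a) - (ln_Gamma (y + a) - ln_Gamma y)"])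
      fix t assume "y \<le> t"
      with that have "t > 0" by simp
      with deriv[OF this] neg[OF this]
      show "\<exists>d. ((\<lambda>y. ln_Gamma (y + a + a) - ln_Gamma (y + a) - (ln_Gamma (y + a) - ln_Gamma y))
          has_real_derivative d) (at t) \<and> d < 0"
        by (intro exI[of _ "Digamma_diff a (t + a) - Digamma_diff a t"]) simp
    qed
    thus ?thesis using that a by (simp add: ln_Gamma_ratio)
  qed
  have "\<exists>Y>0. ?q Y \<le> ln 2"
  proof -
    have "\<forall>\<^sub>F y in at_top. Digamma_diff a y < ln 2 / a"
      using order_tendstoD(2)[OF Digamma_diff_tendsto_0[OF a], of "ln 2 / a"] a by simp
    then obtain Y0 where Y0: "\<And>y. y \<ge> Y0 \<Longrightarrow> Digamma_diff a y < ln 2 / a"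
      by (auto simp: eventually_at_top_linorder)
    define Y where "Y = max Y0 1"
    have Y: "Y > 0" "Y \<ge> Y0" by (auto simp: Y_def)
    have "\<exists>t. Y < t \<and> t < Y + a \<and>
        (ln_Gamma (Y + a + a) - ln_Gamma (Y + a)) - (ln_Gamma (Y + a) - ln_Gamma Y)
          = (Y + a - Y) * Digamma_diff a t"
      unfolding Digamma_diff_def
      using Y a by (intro MVT2) (auto intro!: derivative_eq_intros)
    then obtain t where "Y < t" "?q Y = a * Digamma_diff a t"
      using Y a by (auto simp: ln_Gamma_ratio)
    with Y Y0[of t] a have "?q Y \<le> ln 2" by (auto simp: field_simps)
    with Y show ?thesis by blast
  qed
  then obtain Y where Y: "Y > 0" "?q Y \<le> ln 2" by blast
  \<comment> \<open>Multiplying the equation by \<open>rGamma y\<close> removes the pole at 0: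
    \<open>?g\<close> is continuous on the closed interval and
    \<open>?g 0 = - Gamma (2 * a) < 0\<close>.\<close>
  let ?g = "\<lambda>y. 2 * (Gamma (a + y))\<^sup>2 * rGamma y - Gamma (2 * a + y)"
  have g: "?g y = (2 * (Gamma (a + y))\<^sup>2 - Gamma y * Gamma (2 * a + y)) * rGamma y" if "y > 0" for y
    using that Gamma_real_pos[of y] by (simp add: rGamma_inverse_Gamma field_simps del: Gamma_real_pos)
  have "\<exists>y\<ge>0. y \<le> Y \<and> ?g y = 0"
  proof (rule IVT')
    show "?g 0 \<le> 0" using a by (simp add: less_imp_le)
    show "0 \<le> ?g Y"
      unfolding g[OF Y(1)] using ge_iff[OF Y(1)] Y by (simp add: rGamma_inverse_Gamma)
    show "continuous_on {0..Y} ?g"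
      using a by (intro continuous_intros continuous_on_compose2[OF continuous_on_Gamma[of "{0<..}"]])
        (auto elim!: nonpos_Ints_cases)
  qed (use Y in auto)
  then obtain y0 where y0: "y0 \<ge> 0" "?g y0 = 0" by blast
  have "y0 \<noteq> 0"
  proof
    assume "y0 = 0"
    with y0 have "Gamma (2 * a) = 0" by simp
    thus False using Gamma_real_pos[of "2 * a"] a by linarith
  qed
  with y0 have y0_pos: "y0 > 0" by simp
  hence "?P y0" using y0 g[OF y0_pos] Gamma_real_pos[OF y0_pos] by (simp add: rGamma_inverse_Gamma)
  moreover have "y = z" if "?P y" "?P z" for y z
  proof -
    from that have "?q y = ?q z"
      using le_iff[of y] le_iff[of z] ge_iff[of y] ge_iff[of z] by (intro antisym) auto
    with that dec[of y z] dec[of z y] show ?thesis by (cases y z rule: linorder_cases) auto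
  qed
  ultimately have "\<exists>!y. ?P y" by blast
  from theI'[OF this] have h: "?P (h a)" by (simp add: h_def)
  thus "h a > 0" by simp
  have qh: "?q (h a) = ln 2" using h le_iff[of "h a"] ge_iff[of "h a"] by (intro antisym) auto
  assume y: "y > 0"
  show "h a \<le> y \<longleftrightarrow> Gamma y * Gamma (2 * a + y) \<le> 2 * (Gamma (a + y))\<^sup>2"
    unfolding ge_iff[OF y] qh[symmetric] using dec[of y "h a"] dec[of "h a" y] y h
    by (cases y "h a" rule: linorder_cases) auto
  show "y \<le> h a \<longleftrightarrow> 2 * (Gamma (a + y))\<^sup>2 \<le> Gamma y * Gamma (2 * a + y)"
    unfolding le_iff[OF y] qh[symmetric] using dec[of y "h a"] dec[of "h a" y] y h
    by (cases y "h a" rule: linorder_cases) auto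
qed

section \<open>Quotients of power series\<close>

text \<open>Let \<open>K\<close> be the first index with \<open>d K > 0\<close> and
  \<open>q = y / x\<close>. Then \<open>d k\<close> and \<open>q ^ k - q ^ K\<close> never have
  opposite signs, so the series at \<open>y\<close> is termwise at least \<open>q ^ K\<close> times
  the series at \<open>x\<close>, which is 0.\<close>

lemma power_series_single_sign_change:
  fixes d :: "nat \<Rightarrow> real"
  assumes xy: "0 < x" "x \<le> y"
    and sum_x: "summable (\<lambda>k. d k * x ^ k)" and sum_y: "summable (\<lambda>k. d k * y ^ k)"
    and zero: "(\<Sum>k. d k * x ^ k) = 0"
    and change: "\<And>i j. i \<le> j \<Longrightarrow> d i > 0 \<Longrightarrow> d j \<ge> 0"
  shows "(\<Sum>k. d k * y ^ k) \<ge> 0"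
proof (cases "\<exists>i. d i > 0")
  case True
  define K where "K = (LEAST i. d i > 0)"
  have K: "d K > 0" unfolding K_def using True by (rule LeastI_ex)
  have neg: "d k \<le> 0" if "k < K" for k
    using that not_less_Least[of k "\<lambda>i. d i > 0"] by (auto simp: K_def not_less)
  define q where "q = y / x"
  have q: "q \<ge> 1" and y: "y = x * q" using xy by (auto simp: q_def)
  have termwise: "q ^ K * (d k * x ^ k) \<le> d k * y ^ k" for k
  proof (cases "k < K")
    case True
    hence "q ^ k \<le> q ^ K" using q by (intro power_increasing) auto
    hence "(d k * x ^ k) * q ^ K \<le> (d k * x ^ k) * q ^ k"
      using neg[OF True] xy by (intro mult_left_mono_neg) (auto simp: mult_nonpos_nonneg)
    thus ?thesis by (simp add: y power_mult_distrib mult_ac)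
  next
    case False
    hence "q ^ K \<le> q ^ k" using q by (intro power_increasing) auto
    hence "(d k * x ^ k) * q ^ K \<le> (d k * x ^ k) * q ^ k"
      using change[OF _ K, of k] False xy by (intro mult_left_mono) auto
    thus ?thesis by (simp add: y power_mult_distrib mult_ac)
  qed
  have "0 = (\<Sum>k. q ^ K * (d k * x ^ k))"
    using sum_x zero by (simp add: suminf_mult)
  also have "\<dots> \<le> (\<Sum>k. d k * y ^ k)"
    using termwise sum_x sum_y by (intro suminf_le summable_mult) auto
  finally show ?thesis .
next
  case False
  \<comment> \<open>Terms of one sign with sum 0 all vanish.\<close>
  hence neg: "d k \<le> 0" for k by (auto simp: not_less)
  have "(\<Sum>k. - (d k * x ^ k)) = 0" using zero sum_x by (simp add: suminf_minus)
  hence "- (d k * x ^ k) = 0" for k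
    using neg xy sum_x by (subst (asm) suminf_eq_zero_iff) (auto simp: mult_nonpos_nonneg summable_minus)
  hence "d k = 0" for k using xy by (metis less_irrefl minus_equation_iff minus_zero mult_eq_0_iff power_eq_0_iff)
  thus ?thesis by simp
qed

text \<open>The combination \<open>d\<close> is chosen so that its series vanishes at
  \<open>x\<close>; monotone coefficient ratios give \<open>d\<close> a single sign change, so the
  series is nonnegative at \<open>y\<close>.\<close>

lemma power_series_quotient_mono:
  fixes u v :: "nat \<Rightarrow> real"
  assumes xy: "0 < x" "x \<le> y"
    and sum_u: "\<And>z. summable (\<lambda>k. u k * z ^ k)" and sum_v: "\<And>z. summable (\<lambda>k. v k * z ^ k)"
    and v: "\<And>k. v k > 0"
    and mono: "\<And>i j. i \<le> j \<Longrightarrow> u i * v j \<le> u j * v i"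
  shows "(\<Sum>k. u k * x ^ k) * (\<Sum>k. v k * y ^ k) \<le> (\<Sum>k. u k * y ^ k) * (\<Sum>k. v k * x ^ k)"
proof -
  define U where "U = (\<Sum>k. u k * x ^ k)"
  define V where "V = (\<Sum>k. v k * x ^ k)"
  have V: "V > 0" unfolding V_def using v xy by (intro suminf_pos sum_v) auto
  define d where "d k = V * u k - U * v k" for k
  have d: "(\<lambda>k. d k * z ^ k) sums (V * (\<Sum>k. u k * z ^ k) - U * (\<Sum>k. v k * z ^ k))" for z
    using sums_diff[OF sums_mult[OF summable_sums[OF sum_u]] sums_mult[OF summable_sums[OF sum_v]],
        of V z U z] by (simp add: d_def algebra_simps)
  have "d j \<ge> 0" if "i \<le> j" "d i > 0" for i j
  proof -
    have "0 \<le> v j * d i" using v[of j] that by simp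
    also have "\<dots> \<le> v i * d j"
      using mult_left_mono[OF mono[OF that(1)], of V] V by (simp add: d_def algebra_simps)
    finally show ?thesis using v[of i] by (simp add: zero_le_mult_iff)
  qed
  hence "(\<Sum>k. d k * y ^ k) \<ge> 0"
    using xy d[of x] d[of y]
    by (intro power_series_single_sign_change[of x y])
       (auto simp: sums_iff U_def V_def)
  thus ?thesis using d[of y] by (simp add: sums_iff U_def V_def mult_ac)
qed

text \<open>With the extra value 0 at index -1, \<open>start\<close> is one more instance of
  concavity, and \<open>s k / (k + 1)\<close> is the slope of the chord from that point, which
  decreases for a concave sequence.\<close>

lemma concave_sequence_quotient_antimono:
  fixes s :: "nat \<Rightarrow> real"
  assumes concave: "\<And>k. s k + s (Suc (Suc k)) \<le> 2 * s (Suc k)" and start: "s 1 \<le> 2 * s 0"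
    and ij: "i \<le> j"
  shows "real (Suc i) * s j \<le> real (Suc j) * s i"
proof -
  have step: "real (Suc k) * s (Suc k) \<le> real (Suc (Suc k)) * s k" for k
  proof (induction k)
    case 0
    show ?case using start by simp
  next
    case (Suc k)
    have "real (Suc (Suc k)) * (s k + s (Suc (Suc k))) \<le> real (Suc (Suc k)) * (2 * s (Suc k))"
      by (intro mult_left_mono concave) simp
    with Suc show ?case by (simp add: algebra_simps)
  qed
  have "decseq (\<lambda>k. s k / real (Suc k))"
    using step by (intro decseq_SucI) (simp add: field_simps del: of_nat_Suc)
  from decseqD[OF this ij] show ?thesis by (simp add: field_simps del: of_nat_Suc)
qed

text \<open>The series of \<open>d\<close> is at most its part below degree \<open>K\<close>, which
  for large \<open>x\<close> loses to the single term \<open>c (Suc K) * x ^ Suc K\<close>.\<close>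

lemma power_series_not_dominated:
  fixes c d :: "nat \<Rightarrow> real"
  assumes sum_c: "\<And>x. summable (\<lambda>k. c k * x ^ k)" and sum_d: "\<And>x. summable (\<lambda>k. d k * x ^ k)"
    and c: "\<And>k. c k \<ge> 0" "c (Suc K) > 0" and d: "\<And>k. k \<ge> K \<Longrightarrow> d k \<le> 0"
  shows "\<exists>x\<ge>1. (\<Sum>k. d k * x ^ k) < (\<Sum>k. c k * x ^ k)"
proof -
  define C where "C = (\<Sum>k<K. \<bar>d k\<bar>)"
  \<comment> \<open>This makes \<open>c (Suc K) * x\<close> exceed \<open>C\<close>.\<close>
  define x where "x = C / c (Suc K) + 1"
  have "C \<ge> 0" by (auto simp: C_def intro: sum_nonneg)
  hence x: "x \<ge> 1" using c(2) by (simp add: x_def)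
  have "(\<Sum>k. d k * x ^ k) \<le> (\<Sum>k<K. d k * x ^ k)"
  proof -
    have "- (\<Sum>k<K. d k * x ^ k) = (\<Sum>k<K. - d k * x ^ k)"
      by (simp add: sum_negf)
    also have "\<dots> \<le> (\<Sum>k. - d k * x ^ k)"
      using d x sum_d[of x]
      by (intro sum_le_suminf) (auto simp: mult_nonpos_nonneg summable_minus_iff)
    also have "\<dots> = - (\<Sum>k. d k * x ^ k)"
      using sum_d[of x] by (simp add: suminf_minus)
    finally show ?thesis by simp
  qed
  also have "\<dots> \<le> (\<Sum>k<K. \<bar>d k\<bar> * x ^ K)"
    using x by (intro sum_mono mult_mono power_increasing) auto
  also have "\<dots> = C * x ^ K" by (simp add: C_def sum_distrib_right)
  also have "\<dots> < c (Suc K) * x * x ^ K"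
    using x c(2) by (intro mult_strict_right_mono) (auto simp: x_def field_simps)
  also have "\<dots> = (\<Sum>k\<in>{Suc K}. c k * x ^ k)" by (simp add: mult_ac)
  also have "\<dots> \<le> (\<Sum>k. c k * x ^ k)"
    using c(1) x sum_c by (intro sum_le_suminf) auto
  finally show ?thesis using x by blast
qed

text \<open>For the forward direction, the tangent inequalities at \<open>x\<close> and at
  \<open>y\<close> are added.\<close>

lemma convex_on_pos_iff_deriv_mono:
  fixes g g' :: "real \<Rightarrow> real"
  assumes deriv: "\<And>x. x > 0 \<Longrightarrow> (g has_real_derivative g' x) (at x)"
  shows "convex_on {0<..} g \<longleftrightarrow> (\<forall>x y. 0 < x \<longrightarrow> x \<le> y \<longrightarrow> g' x \<le> g' y)"
proof
  assume convex: "convex_on {0<..} g"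
  have tangent: "g' x * (y - x) \<le> g y - g x" if "x > 0" "y > 0" for x y
    by (rule convex_on_imp_above_tangent[OF convex])
       (use that deriv in \<open>auto simp: interior_open intro: has_field_derivative_at_within\<close>)
  show "\<forall>x y. 0 < x \<longrightarrow> x \<le> y \<longrightarrow> g' x \<le> g' y"
  proof (intro allI impI)
    fix x y :: real assume xy: "0 < x" "x \<le> y"
    have "(g' x - g' y) * (y - x) \<le> 0"
      using tangent[of x y] tangent[of y x] xy by (simp add: algebra_simps)
    thus "g' x \<le> g' y" using xy by (cases "x = y") (auto simp: mult_le_0_iff)
  qed
next
  assume "\<forall>x y. 0 < x \<longrightarrow> x \<le> y \<longrightarrow> g' x \<le> g' y"
  thus "convex_on {0<..} g"
    by (intro convex_on_realI[of _ _ g'] deriv) auto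
qed

section \<open>The Mittag-Leffler function\<close>

locale mittag_leffler_parameters =
  fixes a b :: real
  assumes a: "a > 0" and b: "b \<ge> 0"
begin

definition c :: "nat \<Rightarrow> real" where "c k = rGamma (a * real k + b)"

definition r :: "nat \<Rightarrow> real" where "r k = Gamma_ratio a (a * real k + b)"

definition f :: "real \<Rightarrow> real" where "f x = (\<Sum>k. c k * x ^ k)"

definition f' :: "real \<Rightarrow> real" where "f' x = (\<Sum>k. diffs c k * x ^ k)"

definition f'' :: "real \<Rightarrow> real" where "f'' x = (\<Sum>k. diffs (diffs c) k * x ^ k)"

lemma c_pos: "k > 0 \<or> b > 0 \<Longrightarrow> c k > 0"
  using a b unfolding c_def rGamma_inverse_Gamma
  by (intro positive_imp_inverse_positive Gamma_real_pos) (auto intro: add_pos_nonneg add_nonneg_pos)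

lemma c_nonneg: "c k \<ge> 0"
proof (cases "k > 0 \<or> b > 0")
  case False
  hence "a * real k + b = 0" using b by simp
  thus ?thesis by (simp add: c_def)
qed (simp add: c_pos less_imp_le)

lemma diffs_c_pos: "diffs c k > 0"
  by (simp add: diffs_def c_pos)

text \<open>Identifies \<open>r k\<close> with \<open>c k / c (Suc k)\<close>; for
  \<open>b = 0\<close> both \<open>r 0\<close> and \<open>c 0\<close> are 0.\<close>

lemma c_eq: "c k = r k * c (Suc k)"
proof -
  have "Gamma (a * real k + b + a) > 0" using a b by (intro Gamma_real_pos) (simp add: add_nonneg_pos)
  thus ?thesis by (simp add: c_def r_def Gamma_ratio_def rGamma_inverse_Gamma field_simps)
qed

lemma r_at_top: "filterlim r at_top sequentially"
proof (rule filterlim_at_top_mono)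
  have "filterlim (\<lambda>k. a * real k - 1) at_top sequentially" using a by real_asymp
  moreover have "filterlim (\<lambda>x::real. x powr a) at_top at_top" using a by real_asymp
  ultimately show "filterlim (\<lambda>k. (a * real k - 1) powr a) at_top sequentially"
    by (rule filterlim_compose[rotated])
  have "eventually (\<lambda>k. a * real k > 1) sequentially" using a by real_asymp
  thus "\<forall>\<^sub>F k in sequentially. (a * real k - 1) powr a \<le> r k"
  proof eventually_elim
    case (elim k)
    have "(a * real k - 1) powr a \<le> (a * real k + b - 1) powr a"
      using elim a b by (intro powr_mono2) auto
    also have "\<dots> \<le> r k"
      unfolding r_def using elim a b by (intro Gamma_ratio_lower) auto
    finally show ?case .
  qed
qed

lemma summable_c: "summable (\<lambda>k. c k * x ^ k)"
proof -
  have "\<forall>\<^sub>F k in sequentially. r k \<ge> 2 * (\<bar>x\<bar> + 1)"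
    using r_at_top by (simp add: filterlim_at_top)
  then obtain N where N: "\<And>k. k \<ge> N \<Longrightarrow> r k \<ge> 2 * (\<bar>x\<bar> + 1)"
    by (auto simp: eventually_sequentially)
  show ?thesis
  proof (rule summable_ratio_test[of "1/2" N])
    fix k assume "k \<ge> N"
    hence "2 * \<bar>x\<bar> * c (Suc k) \<le> r k * c (Suc k)"
      using N[of k] c_nonneg by (intro mult_right_mono) auto
    hence "2 * \<bar>x\<bar> * c (Suc k) * \<bar>x\<bar> ^ k \<le> c k * \<bar>x\<bar> ^ k"
      by (intro mult_right_mono) (auto simp: c_eq[of k])
    thus "norm (c (Suc k) * x ^ Suc k) \<le> 1/2 * norm (c k * x ^ k)"
      using c_nonneg by (simp add: abs_mult power_abs mult_ac)
  qed simp
qed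

lemma summable_diffs_c: "summable (\<lambda>k. diffs c k * x ^ k)"
  by (rule termdiff_converges_all[OF summable_c])

lemma summable_diffs2_c: "summable (\<lambda>k. diffs (diffs c) k * x ^ k)"
  by (rule termdiff_converges_all[OF summable_diffs_c])

lemma f_has_derivative: "(f has_real_derivative f' x) (at x)"
  unfolding f_def[abs_def] f'_def
  by (rule termdiffs_strong_converges_everywhere[OF summable_c])

lemma f'_has_derivative: "(f' has_real_derivative f'' x) (at x)"
  unfolding f'_def[abs_def] f''_def
  by (rule termdiffs_strong_converges_everywhere[OF summable_diffs_c])

lemma f_pos: "x > 0 \<Longrightarrow> f x > 0"
proof -
  assume x: "x > 0"
  \<comment> \<open>The term of index 1 is used because \<open>c 0\<close> vanishes for
    \<open>b = 0\<close>.\<close>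
  have "0 < c 1 * x ^ 1" using c_pos[of 1] x by simp
  also have "\<dots> = (\<Sum>k\<in>{1}. c k * x ^ k)" by simp
  also have "\<dots> \<le> f x" unfolding f_def
    using x c_nonneg by (intro sum_le_suminf summable_c) auto
  finally show "f x > 0" .
qed

lemma f'_pos: "x > 0 \<Longrightarrow> f' x > 0"
  unfolding f'_def by (intro suminf_pos summable_diffs_c) (simp add: diffs_c_pos)

lemma mittag_leffler_real_eq: "mittag_leffler_real a b = f"
proof
  fix x
  have "mittag_leffler a b (of_real x) = (\<Sum>k. of_real (c k * x ^ k))"
    by (simp add: mittag_leffler_def c_def rGamma_complex_of_real mult.commute
        del: of_real_add)
  also have "\<dots> = of_real (f x)"
    by (simp only: f_def suminf_of_real[OF summable_c])
  finally show "mittag_leffler_real a b x = f x"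
    by (simp add: mittag_leffler_real_def)
qed

lemma ln_f_has_derivative: "x > 0 \<Longrightarrow> ((\<lambda>x. ln (f x)) has_real_derivative f' x / f x) (at x)"
  using f_pos[of x] by (auto intro!: derivative_eq_intros f_has_derivative)

lemma quotient_has_derivative:
  "x > 0 \<Longrightarrow> ((\<lambda>x. f' x / f x) has_real_derivative (f'' x * f x - (f' x)\<^sup>2) / (f x)\<^sup>2) (at x)"
  using f_pos[of x]
  by (auto intro!: derivative_eq_intros f_has_derivative f'_has_derivative simp: power2_eq_square)

lemma log_convex_iff:
  "log_convex_on {0<..} (mittag_leffler_real a b) \<longleftrightarrow>
     (\<forall>x y. 0 < x \<longrightarrow> x \<le> y \<longrightarrow> f' x / f x \<le> f' y / f y)"
  unfolding log_convex_on_def mittag_leffler_real_eq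
  by (rule convex_on_pos_iff_deriv_mono) (rule ln_f_has_derivative)

lemma log_concave_iff:
  "log_concave_on {0<..} (mittag_leffler_real a b) \<longleftrightarrow>
     (\<forall>x y. 0 < x \<longrightarrow> x \<le> y \<longrightarrow> f' y / f y \<le> f' x / f x)"
proof -
  have "convex_on {0<..} (\<lambda>x. - ln (f x)) \<longleftrightarrow>
      (\<forall>x y. 0 < x \<longrightarrow> x \<le> y \<longrightarrow> - (f' x / f x) \<le> - (f' y / f y))"
    by (rule convex_on_pos_iff_deriv_mono) (intro DERIV_minus ln_f_has_derivative)
  thus ?thesis unfolding log_concave_on_def concave_on_def mittag_leffler_real_eq by simp
qed

section \<open>Necessary conditions on \<open>b\<close> and on \<open>a\<close>\<close>

text \<open>This is the numerator of the derivative of \<open>f' / f\<close>. Its sign is known only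
  for \<open>x > 0\<close>, so the inequality between the first three coefficients is obtained as a
  one-sided limit.\<close>

lemma wronskian_tendsto:
  "((\<lambda>x. f'' x * f x - (f' x)\<^sup>2) \<longlongrightarrow> 2 * c 2 * c 0 - (c 1)\<^sup>2) (at_right 0)"
proof -
  have "continuous_on UNIV f''" unfolding f''_def[abs_def]
    by (rule DERIV_continuous_on)
       (rule termdiffs_strong_converges_everywhere[OF summable_diffs2_c])
  hence "isCont f'' 0" by (simp add: continuous_on_eq_continuous_at)
  moreover have "isCont f' 0" "isCont f 0"
    using f_has_derivative f'_has_derivative by (blast intro: DERIV_isCont)+
  ultimately have "isCont (\<lambda>x. f'' x * f x - (f' x)\<^sup>2) 0" by (intro continuous_intros)
  moreover have "f 0 = c 0" "f' 0 = c 1" "f'' 0 = 2 * c 2"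
    by (simp_all add: f_def f'_def f''_def diffs_def numeral_2_eq_2)
  ultimately show ?thesis by (auto simp: isCont_def intro: tendsto_within_subset)
qed

lemma log_convex_imp_coeff:
  assumes "log_convex_on {0<..} (mittag_leffler_real a b)"
  shows "(c 1)\<^sup>2 \<le> 2 * c 2 * c 0"
proof -
  have mono: "mono_on {0<..} (\<lambda>x. f' x / f x)"
    using assms by (auto simp: log_convex_iff mono_on_def)
  have "f'' x * f x - (f' x)\<^sup>2 \<ge> 0" if "x > 0" for x
    using mono_on_imp_deriv_nonneg[OF mono quotient_has_derivative[OF that]] that f_pos[OF that]
    by (simp add: interior_open zero_le_divide_iff)
  hence "0 \<le> 2 * c 2 * c 0 - (c 1)\<^sup>2"
    by (intro tendsto_lowerbound[OF wronskian_tendsto]) (auto simp: eventually_at_right_less eventually_at_filter)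
  thus ?thesis by simp
qed

lemma log_concave_imp_coeff:
  assumes "log_concave_on {0<..} (mittag_leffler_real a b)"
  shows "2 * c 2 * c 0 \<le> (c 1)\<^sup>2"
proof -
  have mono: "mono_on {0<..} (\<lambda>x. - (f' x / f x))"
    using assms by (auto simp: log_concave_iff mono_on_def)
  have "f'' x * f x - (f' x)\<^sup>2 \<le> 0" if "x > 0" for x
    using mono_on_imp_deriv_nonneg[OF mono DERIV_minus[OF quotient_has_derivative[OF that]]]
      that f_pos[OF that]
    by (simp add: interior_open divide_le_0_iff)
  hence "2 * c 2 * c 0 - (c 1)\<^sup>2 \<le> 0"
    by (intro tendsto_upperbound[OF wronskian_tendsto]) (auto simp: eventually_at_filter)
  thus ?thesis by simp
qed

text \<open>Monotonicity keeps \<open>f' / f\<close> at least \<open>2 * e\<close> on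
  \<open>{1..}\<close>. For \<open>a > 1\<close> the coefficients of \<open>f' / e - f\<close> are
  eventually nonpositive, so this function falls below \<open>f\<close> somewhere, that is,
  \<open>f' < 2 * e * f\<close>.\<close>

lemma log_convex_imp_a_le_1:
  assumes "log_convex_on {0<..} (mittag_leffler_real a b)"
  shows "a \<le> 1"
proof (rule ccontr)
  assume "\<not> a \<le> 1"
  hence a1: "a > 1" by simp
  define e where "e = f' 1 / f 1 / 2"
  have e: "e > 0" using f_pos[of 1] f'_pos[of 1] by (simp add: e_def)
  have "\<forall>\<^sub>F k in sequentially. real (Suc k) \<le> e * (a * real k - 1) powr a \<and> a * real k > 1"
    using a1 e by (intro eventually_conj) real_asymp+
  then obtain K where K: "\<And>k. k \<ge> K \<Longrightarrow> real (Suc k) \<le> e * (a * real k - 1) powr a \<and> a * real k > 1"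
    by (auto simp: eventually_sequentially)
  define d where "d k = (1 / e) * diffs c k - c k" for k
  have sums_d: "(\<lambda>k. d k * x ^ k) sums (f' x / e - f x)" for x
    using sums_diff[OF sums_mult[OF summable_sums[OF summable_diffs_c]] summable_sums[OF summable_c],
        of "1 / e" x x]
    by (simp add: d_def f_def f'_def algebra_simps)
  have "d k \<le> 0" if "k \<ge> K" for k
  proof -
    have "real (Suc k) \<le> e * (a * real k - 1) powr a" using K[OF that] by simp
    also have "\<dots> \<le> e * (a * real k + b - 1) powr a"
      using K[OF that] a b e by (intro mult_left_mono powr_mono2) auto
    also have "\<dots> \<le> e * r k"
      unfolding r_def using K[OF that] a b e by (intro mult_left_mono Gamma_ratio_lower) auto
    finally have "real (Suc k) * c (Suc k) \<le> e * r k * c (Suc k)"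
      by (intro mult_right_mono c_nonneg)
    thus ?thesis using e by (simp add: d_def diffs_def c_eq[of k] field_simps)
  qed
  moreover have "summable (\<lambda>k. d k * x ^ k)" for x using sums_d[of x] by (simp add: sums_iff)
  ultimately obtain x where x: "x \<ge> 1" "(\<Sum>k. d k * x ^ k) < (\<Sum>k. c k * x ^ k)"
    using power_series_not_dominated[of c d K] summable_c c_nonneg c_pos[of "Suc K"] by blast
  have "f' 1 / f 1 \<le> f' x / f x" using assms x by (simp add: log_convex_iff)
  hence "2 * e * f x \<le> f' x" using f_pos[of x] x by (simp add: e_def field_simps)
  hence "f x \<le> f' x / e - f x" using e by (simp add: field_simps)
  moreover have "f' x / e - f x < f x" using x sums_d[of x] by (simp add: sums_iff f_def)
  ultimately show False by simp
qed

text \<open>Monotonicity keeps \<open>f' / f\<close> at most \<open>M - 1\<close> on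
  \<open>{1..}\<close>. For \<open>a < 1\<close> the coefficients of \<open>M * f - f'\<close> are
  eventually nonpositive, so this function falls below \<open>f\<close> somewhere, that is,
  \<open>f' > (M - 1) * f\<close>.\<close>

lemma log_concave_imp_a_ge_1:
  assumes "log_concave_on {0<..} (mittag_leffler_real a b)"
  shows "a \<ge> 1"
proof (rule ccontr)
  assume "\<not> a \<ge> 1"
  hence a1: "a < 1" by simp
  define M where "M = f' 1 / f 1 + 1"
  have M: "M > 0" using f_pos[of 1] f'_pos[of 1] by (simp add: M_def add_pos_pos)
  have "\<forall>\<^sub>F k in sequentially. real (Suc k) \<ge> M * (a * real k + b + a) powr a"
    using a a1 M by real_asymp
  then obtain K0 where K0: "\<And>k. k \<ge> K0 \<Longrightarrow> real (Suc k) \<ge> M * (a * real k + b + a) powr a"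
    by (auto simp: eventually_sequentially)
  \<comment> \<open>The shift gives \<open>k > 0\<close>, so the argument \<open>a * k + b\<close>
    is positive, as the upper bound on \<open>Gamma_ratio\<close> requires.\<close>
  define K where "K = Suc K0"
  define d where "d k = M * c k - diffs c k" for k
  have sums_d: "(\<lambda>k. d k * x ^ k) sums (M * f x - f' x)" for x
    using sums_diff[OF sums_mult[OF summable_sums[OF summable_c]] summable_sums[OF summable_diffs_c],
        of M x x]
    by (simp add: d_def f_def f'_def algebra_simps)
  have "d k \<le> 0" if "k \<ge> K" for k
  proof -
    have "M * r k \<le> M * (a * real k + b + a) powr a"
      unfolding r_def using that a b M
      by (intro mult_left_mono Gamma_ratio_upper) (auto simp: K_def add_pos_nonneg)
    also have "\<dots> \<le> real (Suc k)" using K0[of k] that by (simp add: K_def)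
    finally have "M * r k * c (Suc k) \<le> real (Suc k) * c (Suc k)"
      by (intro mult_right_mono c_nonneg)
    thus ?thesis by (simp add: d_def diffs_def c_eq[of k])
  qed
  moreover have "summable (\<lambda>k. d k * x ^ k)" for x using sums_d[of x] by (simp add: sums_iff)
  ultimately obtain x where x: "x \<ge> 1" "(\<Sum>k. d k * x ^ k) < (\<Sum>k. c k * x ^ k)"
    using power_series_not_dominated[of c d K] summable_c c_nonneg c_pos[of "Suc K"] by blast
  have "f' x / f x \<le> f' 1 / f 1" using assms x by (simp add: log_concave_iff)
  hence "f' x / f x \<le> M - 1" by (simp add: M_def)
  hence "f' x \<le> (M - 1) * f x" using f_pos[of x] x by (simp add: field_simps)
  moreover have "M * f x - f' x < f x" using x sums_d[of x] by (simp add: sums_iff f_def)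
  ultimately show False by (simp add: algebra_simps)
qed

section \<open>Sufficient conditions and the link to \<open>h\<close>\<close>

text \<open>Expressing \<open>c 0\<close> and \<open>c 1\<close> through \<open>r 0\<close>,
  \<open>r 1\<close> and \<open>c 2\<close> leaves the positive factor
  \<open>r 1 * (c 2)\<^sup>2\<close> common to both sides.\<close>

lemma r_le_iff: "b > 0 \<Longrightarrow> r 1 \<le> 2 * r 0 \<longleftrightarrow> (c 1)\<^sup>2 \<le> 2 * c 2 * c 0"
  and r_ge_iff: "2 * r 0 \<le> r 1 \<longleftrightarrow> 2 * c 2 * c 0 \<le> (c 1)\<^sup>2"
proof -
  have "c 1 > 0" "c 2 > 0" by (auto intro: c_pos)
  moreover have "c 0 = r 0 * (r 1 * c 2)" "c 1 = r 1 * c 2"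
    using c_eq[of 0] c_eq[of 1] by (simp_all add: numeral_2_eq_2)
  moreover have "r 1 > 0" using calculation by (simp add: zero_less_mult_iff)
  ultimately show "r 1 \<le> 2 * r 0 \<longleftrightarrow> (c 1)\<^sup>2 \<le> 2 * c 2 * c 0"
    and "2 * r 0 \<le> r 1 \<longleftrightarrow> 2 * c 2 * c 0 \<le> (c 1)\<^sup>2"
    by (simp_all add: power2_eq_square)
qed

text \<open>Compares the coefficient ratios of \<open>f'\<close> and \<open>f\<close> in
  cross-multiplied form, since \<open>c 0\<close> may be 0.\<close>

lemma quotient_coeff:
  "diffs c i * c j \<le> diffs c j * c i \<longleftrightarrow> real (Suc i) * r j \<le> real (Suc j) * r i"
proof -
  have "diffs c i * c j = (real (Suc i) * r j) * (c (Suc i) * c (Suc j))"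
    and "diffs c j * c i = (real (Suc j) * r i) * (c (Suc i) * c (Suc j))"
    by (simp_all add: diffs_def c_eq[of i] c_eq[of j])
  moreover have "c (Suc i) * c (Suc j) > 0" by (simp add: c_pos)
  ultimately show ?thesis by (simp only: mult_le_cancel_right_pos)
qed

lemma log_convexI:
  assumes "a \<le> 1" "b > 0" "(c 1)\<^sup>2 \<le> 2 * c 2 * c 0"
  shows "log_convex_on {0<..} (mittag_leffler_real a b)"
proof -
  have "r k + r (Suc (Suc k)) \<le> 2 * r (Suc k)" for k
    using Gamma_ratio_second_difference_nonpos[of a "a * real k + b"] a assms(1,2)
      add_nonneg_pos[of "a * real k" b]
    by (simp add: r_def algebra_simps)
  hence "real (Suc i) * r j \<le> real (Suc j) * r i" if "i \<le> j" for i j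
    using concave_sequence_quotient_antimono[of r i j] that assms r_le_iff by simp
  hence "f' x * f y \<le> f' y * f x" if "0 < x" "x \<le> y" for x y
    unfolding f_def f'_def using that assms
    by (intro power_series_quotient_mono summable_c summable_diffs_c)
       (auto simp: c_pos quotient_coeff)
  thus ?thesis unfolding log_convex_iff using f_pos by (auto simp: field_simps)
qed

lemma log_concaveI:
  assumes "a \<ge> 1" "2 * c 2 * c 0 \<le> (c 1)\<^sup>2"
  shows "log_concave_on {0<..} (mittag_leffler_real a b)"
proof -
  have "- r k + - r (Suc (Suc k)) \<le> 2 * - r (Suc k)" for k
    using Gamma_ratio_second_difference_nonneg[of a "a * real k + b"] a b assms
    by (simp add: r_def algebra_simps)
  \<comment> \<open>Convexity of \<open>r\<close> is concavity of its negative, and the coefficient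
    inequality supplies the starting step.\<close>
  hence "real (Suc i) * - r j \<le> real (Suc j) * - r i" if "i \<le> j" for i j
    using concave_sequence_quotient_antimono[of "\<lambda>k. - r k" i j] that assms r_ge_iff by simp
  hence "real (Suc j) * r i \<le> real (Suc i) * r j" if "i \<le> j" for i j
    using that by fastforce
  \<comment> \<open>The roles are swapped to make \<open>f / f'\<close> increasing: the denominator
    series needs positive coefficients, which \<open>f'\<close> has even for
    \<open>b = 0\<close>.\<close>
  hence "f x * f' y \<le> f y * f' x" if "0 < x" "x \<le> y" for x y
    unfolding f_def f'_def using that assms quotient_coeff
    by (intro power_series_quotient_mono summable_c summable_diffs_c)
       (auto simp: diffs_c_pos mult.commute)
  thus ?thesis unfolding log_concave_iff using f_pos by (auto simp: field_simps)
qed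

text \<open>Clearing the reciprocals of \<open>Gamma\<close> from the coefficient inequalities
  yields exactly the comparisons that characterise \<open>h a\<close>.\<close>

lemma coeff_iff_h:
  assumes "b > 0"
  shows "(c 1)\<^sup>2 \<le> 2 * c 2 * c 0 \<longleftrightarrow> h a \<le> b"
    and "2 * c 2 * c 0 \<le> (c 1)\<^sup>2 \<longleftrightarrow> b \<le> h a"
proof -
  have "Gamma b > 0" "Gamma (a + b) > 0" "Gamma (2 * a + b) > 0" using a assms by auto
  moreover have "c 0 = 1 / Gamma b" "c 1 = 1 / Gamma (a + b)" "c 2 = 1 / Gamma (2 * a + b)"
    by (simp_all add: c_def rGamma_inverse_Gamma inverse_eq_divide mult.commute)
  ultimately show "(c 1)\<^sup>2 \<le> 2 * c 2 * c 0 \<longleftrightarrow> h a \<le> b"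
    and "2 * c 2 * c 0 \<le> (c 1)\<^sup>2 \<longleftrightarrow> b \<le> h a"
    unfolding h_threshold(2,3)[OF a assms] \<open>c 0 = _\<close> \<open>c 1 = _\<close> \<open>c 2 = _\<close>
    by (simp_all add: power_divide divide_simps) (auto simp: mult_ac)
qed

end

theorem theorem23:
  fixes \<alpha> \<beta> :: real
  assumes "\<alpha> > 0" and "\<beta> \<ge> 0"
  shows "(log_convex_on {0<..} (mittag_leffler_real \<alpha> \<beta>) \<longleftrightarrow> \<alpha> \<le> 1 \<and> \<beta> \<ge> h \<alpha>)
       \<and> (log_concave_on {0<..} (mittag_leffler_real \<alpha> \<beta>) \<longleftrightarrow> \<alpha> \<ge> 1 \<and> \<beta> \<le> h \<alpha>)"
proof -
  interpret mittag_leffler_parameters \<alpha> \<beta>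
    using assms by unfold_locales
  have h: "h \<alpha> > 0" using h_threshold(1) assms by blast
  show ?thesis
  proof (cases "\<beta> = 0")
    case True
    \<comment> \<open>Here 0 lies below the threshold \<open>h \<alpha> > 0\<close>, and
      \<open>c 0 = 0\<close> makes the coefficient inequality strict: log-convexity is excluded and
      the starting condition for log-concavity holds.\<close>
    hence "c 0 = 0" by (subst c_def) simp
    moreover have "c 1 > 0" by (rule c_pos) simp
    ultimately have "2 * c 2 * c 0 < (c 1)\<^sup>2" by simp
    moreover have "\<not> h \<alpha> \<le> \<beta>" "\<beta> \<le> h \<alpha>" using h True by auto
    ultimately show ?thesis
      using log_convex_imp_coeff log_concave_imp_a_ge_1 log_concaveI by fastforce
  next
    case False
    with assms have "\<beta> > 0" by simp
    thus ?thesis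
      using log_convex_imp_coeff log_convex_imp_a_le_1 log_convexI
        log_concave_imp_coeff log_concave_imp_a_ge_1 log_concaveI coeff_iff_h by blast
  qed
qed

end
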